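(* Let $\mathbb D=\{z\in\mathbb C:|z|<1\}$. The real vector space of all harmonic functions $u:\mathbb D\to\mathbb R$ that have nontangential limit $0$ at every point of $\partial\mathbb D$ except for a countable collection of points of $\partial\mathbb D$ (i.e. for which there is a countable set $E\subset\partial\mathbb D$, possibly depending on $u$, such that $u$ has nontangential limit $0$ at every $\zeta\in\partial\mathbb D\setminus E$) is infinite-dimensional.
   Context: A function $u:\mathbb D\to\mathbb R$ has nontangential limit $L$ at $\zeta\in\partial\mathbb D$ if for every $M>1$ one has $u(z)\to L$ as $z\to\zeta$ with $z$ restricted to the region $\{z\in\mathbb D:|z-\zeta|<M(1-|z|)\}$. "Countable" means finite or countably infinite. *)

theory Defs
  imports "HOL-Analysis.Analysis" "HOL-Library.Function_Algebras"
begin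

instantiation "fun" :: (type, real_vector) real_vector
begin

definition scaleR_fun :: "real \<Rightarrow> ('a \<Rightarrow> 'b) \<Rightarrow> 'a \<Rightarrow> 'b"
  where "scaleR_fun c f = (\<lambda>x. c *\<^sub>R f x)"

instance
  by standard (simp_all add: scaleR_fun_def fun_eq_iff algebra_simps)

end

lemma scaleR_fun_apply [simp]: "(c *\<^sub>R f) x = c *\<^sub>R f x"
  by (simp add: scaleR_fun_def)

text \<open>For a subspace \<open>V\<close>, the inclusion \<open>V \<subseteq> span B\<close> for some finite \<open>B\<close>, not required to lie
  in \<open>V\<close>, is equivalent to \<open>V\<close> having a finite basis. (The library's \<open>dim V\<close> is a natural
  number, so it cannot express infinite dimension.)\<close>

definition infinite_dimensional :: "'a::real_vector set \<Rightarrow> bool"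
  where "infinite_dimensional V \<longleftrightarrow> \<not> (\<exists>B. finite B \<and> V \<subseteq> span B)"

text \<open>Twice continuously differentiable with vanishing Laplacian; \<open>u'\<close> and \<open>u''\<close> are the first
  and second Frechet derivatives of \<open>u\<close>, so \<open>u'' z b b\<close> is the second partial derivative of
  \<open>u\<close> at \<open>z\<close> in direction \<open>b\<close>.\<close>

definition harmonic_on :: "'a::euclidean_space set \<Rightarrow> ('a \<Rightarrow> real) \<Rightarrow> bool"
  where "harmonic_on S u \<longleftrightarrow> open S \<and>
    (\<exists>(u' :: 'a \<Rightarrow> 'a \<Rightarrow>\<^sub>L real) (u'' :: 'a \<Rightarrow> 'a \<Rightarrow>\<^sub>L 'a \<Rightarrow>\<^sub>L real).
      (\<forall>z\<in>S. (u has_derivative blinfun_apply (u' z)) (at z)) \<and>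
      (\<forall>z\<in>S. (u' has_derivative blinfun_apply (u'' z)) (at z)) \<and>
      continuous_on S u'' \<and>
      (\<forall>z\<in>S. (\<Sum>b\<in>Basis. blinfun_apply (blinfun_apply (u'' z) b) b) = 0))"

definition nontangential_region :: "real \<Rightarrow> complex \<Rightarrow> complex set"
  where "nontangential_region M \<zeta> = {z \<in> ball 0 1. cmod (z - \<zeta>) < M * (1 - cmod z)}"

definition has_nontangential_limit :: "(complex \<Rightarrow> real) \<Rightarrow> real \<Rightarrow> complex \<Rightarrow> bool"
  where "has_nontangential_limit u L \<zeta> \<longleftrightarrow>
    (\<forall>M>1. (u \<longlongrightarrow> L) (at \<zeta> within nontangential_region M \<zeta>))"

text \<open>A function on the open unit disc is represented by its extension by \<open>0\<close> to the whole
  plane. This makes the representation unique, so that the real vector space of functions on the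
  disc is a subspace of \<^typ>\<open>complex \<Rightarrow> real\<close>.\<close>

definition harmonic_null_functions :: "(complex \<Rightarrow> real) set"
  where "harmonic_null_functions =
    {u. (\<forall>z. z \<notin> ball 0 1 \<longrightarrow> u z = 0) \<and>
        harmonic_on (ball 0 1) u \<and>
        (\<exists>E. countable E \<and> E \<subseteq> sphere 0 1 \<and>
             (\<forall>\<zeta> \<in> sphere 0 1 - E. has_nontangential_limit u 0 \<zeta>))}"

end

theory Submission
  imports Defs "HOL-Complex_Analysis.Cauchy_Integral_Formula"
begin

text \<open>The Poisson kernels \<open>P a z = Re ((a + z) / (a - z))\<close>, \<open>\<bar>a\<bar> = 1\<close>, lie in the space, each with
  the single exceptional point \<open>a\<close>. Since \<open>(1 - r) * P b (r * a)\<close> tends to \<open>2\<close> as \<open>r\<close> increases to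
  \<open>1\<close> if \<open>b = a\<close> and to \<open>0\<close> otherwise, they are linearly independent.\<close>

subsection \<open>Harmonic functions\<close>

lemma harmonic_on_zero:
  assumes "open S"
  shows "harmonic_on S 0"
  unfolding harmonic_on_def
proof (intro conjI exI[of _ "\<lambda>_. 0"] ballI)
  show "((0::'a \<Rightarrow> real) has_derivative blinfun_apply 0) (at z)" for z
    by (simp add: zero_fun_def zero_blinfun.rep_eq)
  show "((\<lambda>_. 0 :: 'a \<Rightarrow>\<^sub>L real) has_derivative blinfun_apply 0) (at z)" for z
    by (simp add: zero_blinfun.rep_eq)
qed (use assms in auto)

lemma harmonic_on_add:
  assumes "harmonic_on S u" "harmonic_on S v"
  shows "harmonic_on S (u + v)"
proof -
  obtain u' u'' where u: "open S"
    "\<And>z. z \<in> S \<Longrightarrow> (u has_derivative blinfun_apply (u' z)) (at z)"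
    "\<And>z. z \<in> S \<Longrightarrow> (u' has_derivative blinfun_apply (u'' z)) (at z)"
    "continuous_on S u''" "\<And>z. z \<in> S \<Longrightarrow> (\<Sum>b\<in>Basis. u'' z b b) = 0"
    using assms(1) unfolding harmonic_on_def by blast
  obtain v' v'' where v:
    "\<And>z. z \<in> S \<Longrightarrow> (v has_derivative blinfun_apply (v' z)) (at z)"
    "\<And>z. z \<in> S \<Longrightarrow> (v' has_derivative blinfun_apply (v'' z)) (at z)"
    "continuous_on S v''" "\<And>z. z \<in> S \<Longrightarrow> (\<Sum>b\<in>Basis. v'' z b b) = 0"
    using assms(2) unfolding harmonic_on_def by blast
  show ?thesis
    unfolding harmonic_on_def
  proof (intro conjI exI[of _ "\<lambda>z. u' z + v' z"] exI[of _ "\<lambda>z. u'' z + v'' z"] ballI)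
    fix z assume z: "z \<in> S"
    show "(u + v has_derivative blinfun_apply (u' z + v' z)) (at z)"
      using has_derivative_add[OF u(2) v(1), OF z z]
      by (simp add: plus_fun_def plus_blinfun.rep_eq)
    show "((\<lambda>z. u' z + v' z) has_derivative blinfun_apply (u'' z + v'' z)) (at z)"
      using has_derivative_add[OF u(3) v(2), OF z z] by (simp add: plus_blinfun.rep_eq)
    show "(\<Sum>b\<in>Basis. (u'' z + v'' z) b b) = 0"
      using u(5)[OF z] v(4)[OF z] by (simp add: plus_blinfun.rep_eq sum.distrib)
  next
    show "continuous_on S (\<lambda>z. u'' z + v'' z)"
      by (intro continuous_on_add u v)
  qed (rule u)
qed

lemma harmonic_on_scaleR:
  assumes "harmonic_on S u"
  shows "harmonic_on S (c *\<^sub>R u)"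
proof -
  obtain u' u'' where u: "open S"
    "\<And>z. z \<in> S \<Longrightarrow> (u has_derivative blinfun_apply (u' z)) (at z)"
    "\<And>z. z \<in> S \<Longrightarrow> (u' has_derivative blinfun_apply (u'' z)) (at z)"
    "continuous_on S u''" "\<And>z. z \<in> S \<Longrightarrow> (\<Sum>b\<in>Basis. u'' z b b) = 0"
    using assms(1) unfolding harmonic_on_def by blast
  show ?thesis
    unfolding harmonic_on_def
  proof (intro conjI exI[of _ "\<lambda>z. c *\<^sub>R u' z"] exI[of _ "\<lambda>z. c *\<^sub>R u'' z"] ballI)
    fix z assume z: "z \<in> S"
    show "(c *\<^sub>R u has_derivative blinfun_apply (c *\<^sub>R u' z)) (at z)"
      using has_derivative_scaleR_right[OF u(2)[OF z], of c]
      by (simp add: scaleR_fun_def scaleR_blinfun.rep_eq)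
    show "((\<lambda>z. c *\<^sub>R u' z) has_derivative blinfun_apply (c *\<^sub>R u'' z)) (at z)"
      using has_derivative_scaleR_right[OF u(3)[OF z], of c]
      by (simp add: scaleR_blinfun.rep_eq)
    show "(\<Sum>b\<in>Basis. (c *\<^sub>R u'' z) b b) = 0"
      using u(5)[OF z] by (simp add: scaleR_blinfun.rep_eq flip: sum_distrib_left)
  next
    show "continuous_on S (\<lambda>z. c *\<^sub>R u'' z)"
      by (intro continuous_on_scaleR continuous_on_const u)
  qed (rule u)
qed

text \<open>With complex derivatives \<open>f'\<close> and \<open>f''\<close>, the Frechet
  derivatives of \<open>Re f\<close> send \<open>h\<close> to \<open>Re (f' * h)\<close> and
  \<open>h\<close>, \<open>k\<close> to \<open>Re (f'' * h * k)\<close>; on the diagonal, the latter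
  takes opposite values at \<open>1\<close> and \<open>\<i>\<close>. Agreement with
  \<open>Re f\<close> is asked only on \<open>S\<close>, which admits functions extended by
  0.\<close>

lemma harmonic_on_Re_holomorphic:
  assumes "f holomorphic_on S" "open S" and u: "\<And>z. z \<in> S \<Longrightarrow> u z = Re (f z)"
  shows "harmonic_on S u"
proof -
  \<comment> \<open>\<open>R w\<close> is the functional sending \<open>h\<close> to
    \<open>Re (w * h)\<close>. Since \<open>R\<close> is bounded linear in \<open>w\<close>, the
    derivative of \<open>R\<close> composed with \<open>f'\<close> follows from that of
    \<open>f'\<close>.\<close>
  define R :: "complex \<Rightarrow> complex \<Rightarrow>\<^sub>L real"
    where "R w = Blinfun Re o\<^sub>L blinfun_mult_right w" for w
  have R_apply: "blinfun_apply (R w) h = Re (w * h)" for w h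
    by (simp add: R_def bounded_linear_Blinfun_apply bounded_linear_Re blinfun_mult_right.rep_eq)
  have R: "bounded_linear R"
    unfolding R_def
    by (intro bounded_linear_compose[OF bounded_bilinear.bounded_linear_right
          [OF bounded_bilinear_blinfun_compose]] bounded_linear_blinfun_mult_right)
  \<comment> \<open>The same construction one level up: \<open>Q w h k = Re (w * h * k)\<close>, the
    second derivative once \<open>w\<close> is \<open>f''\<close>.\<close>
  define Q where "Q w = Blinfun R o\<^sub>L blinfun_mult_right w" for w
  have Q_apply: "blinfun_apply (Q w) h = R (w * h)" for w h
    by (simp add: Q_def bounded_linear_Blinfun_apply R blinfun_mult_right.rep_eq)
  have Q: "bounded_linear Q"
    unfolding Q_def
    by (intro bounded_linear_compose[OF bounded_bilinear.bounded_linear_right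
          [OF bounded_bilinear_blinfun_compose]] bounded_linear_blinfun_mult_right)
  have f': "deriv f holomorphic_on S" and f'': "deriv (deriv f) holomorphic_on S"
    using assms by (auto intro!: holomorphic_deriv)
  show ?thesis
    unfolding harmonic_on_def
  proof (intro conjI exI[of _ "\<lambda>z. R (deriv f z)"] exI[of _ "\<lambda>z. Q (deriv (deriv f) z)"] ballI)
    fix z assume z: "z \<in> S"
    have "((\<lambda>z. Re (f z)) has_derivative (\<lambda>h. Re (deriv f z * h))) (at z)"
      using holomorphic_derivI[OF assms(1,2) z]
      by (intro bounded_linear.has_derivative[OF bounded_linear_Re])
        (simp add: has_field_derivative_def)
    then show "(u has_derivative blinfun_apply (R (deriv f z))) (at z)"
      unfolding R_apply[abs_def]
      by (rule has_derivative_transform_within_open[OF _ assms(2) z]) (simp add: u)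
    show "((\<lambda>z. R (deriv f z)) has_derivative blinfun_apply (Q (deriv (deriv f) z))) (at z)"
      unfolding Q_apply[abs_def] using holomorphic_derivI[OF f' assms(2) z]
      by (intro bounded_linear.has_derivative[OF R]) (simp add: has_field_derivative_def)
    \<comment> \<open>The basis is \<open>1\<close> and \<open>\<i>\<close>, so with
      \<open>w\<close> the second complex derivative the sum is
      \<open>Re w + Re (w * \<i> * \<i>) = Re w - Re w\<close>.\<close>
    show "(\<Sum>b\<in>Basis. Q (deriv (deriv f) z) b b) = 0"
      by (simp add: Basis_complex_def Q_apply R_apply)
  next
    show "continuous_on S (\<lambda>z. Q (deriv (deriv f) z))"
      by (intro bounded_linear.continuous_on[OF Q] holomorphic_on_imp_continuous_on f'')
  qed fact
qed

section \<open>Vector space structure\<close>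

lemma subspace_harmonic_null_functions: "subspace harmonic_null_functions"
  unfolding subspace_def
proof (intro conjI ballI allI)
  show "0 \<in> harmonic_null_functions"
    unfolding harmonic_null_functions_def
  proof (intro CollectI conjI exI[of _ "{}"] ballI)
    show "has_nontangential_limit 0 0 \<zeta>" for \<zeta>
      by (simp add: has_nontangential_limit_def zero_fun_def)
  qed (simp_all add: harmonic_on_zero)
next
  fix u v :: "complex \<Rightarrow> real"
  assume u_mem: "u \<in> harmonic_null_functions" and v_mem: "v \<in> harmonic_null_functions"
  from u_mem obtain E where
    u: "\<forall>z. z \<notin> ball 0 1 \<longrightarrow> u z = 0" "harmonic_on (ball 0 1) u"
      "countable E" "E \<subseteq> sphere 0 1"
      "\<forall>\<zeta> \<in> sphere 0 1 - E. has_nontangential_limit u 0 \<zeta>"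
    unfolding harmonic_null_functions_def by (elim CollectE conjE exE) (rule that)
  from v_mem obtain F where
    v: "\<forall>z. z \<notin> ball 0 1 \<longrightarrow> v z = 0" "harmonic_on (ball 0 1) v"
      "countable F" "F \<subseteq> sphere 0 1"
      "\<forall>\<zeta> \<in> sphere 0 1 - F. has_nontangential_limit v 0 \<zeta>"
    unfolding harmonic_null_functions_def by (elim CollectE conjE exE) (rule that)
  show "u + v \<in> harmonic_null_functions"
    unfolding harmonic_null_functions_def
  \<comment> \<open>The exceptional set depends on the function; off the union, still countable,
    both limits are available.\<close>
  proof (intro CollectI conjI exI[of _ "E \<union> F"] ballI allI impI)
    show "harmonic_on (ball 0 1) (u + v)"
      using u(2) v(2) by (rule harmonic_on_add)
    show "(u + v) z = 0" if "z \<notin> ball 0 1" for z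
      using u(1) v(1) that by simp
    show "has_nontangential_limit (u + v) 0 \<zeta>" if "\<zeta> \<in> sphere 0 1 - (E \<union> F)" for \<zeta>
      unfolding has_nontangential_limit_def plus_fun_def
    proof (intro allI impI tendsto_add_zero)
      fix M :: real
      assume "M > 1"
      then show "(u \<longlongrightarrow> 0) (at \<zeta> within nontangential_region M \<zeta>)"
        "(v \<longlongrightarrow> 0) (at \<zeta> within nontangential_region M \<zeta>)"
        using u(5) v(5) that unfolding has_nontangential_limit_def by blast+
    qed
  qed (use u(3,4) v(3,4) in \<open>simp_all\<close>)
next
  fix u :: "complex \<Rightarrow> real" and c :: real
  assume "u \<in> harmonic_null_functions"
  then obtain E where
    u: "\<forall>z. z \<notin> ball 0 1 \<longrightarrow> u z = 0" "harmonic_on (ball 0 1) u"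
      "countable E" "E \<subseteq> sphere 0 1"
      "\<forall>\<zeta> \<in> sphere 0 1 - E. has_nontangential_limit u 0 \<zeta>"
    unfolding harmonic_null_functions_def by (elim CollectE conjE exE) (rule that)
  show "c *\<^sub>R u \<in> harmonic_null_functions"
    unfolding harmonic_null_functions_def
  proof (intro CollectI conjI exI[of _ E] ballI allI impI)
    show "harmonic_on (ball 0 1) (c *\<^sub>R u)"
      using u(2) by (rule harmonic_on_scaleR)
    show "(c *\<^sub>R u) z = 0" if "z \<notin> ball 0 1" for z
      using u(1) that by simp
    show "has_nontangential_limit (c *\<^sub>R u) 0 \<zeta>" if "\<zeta> \<in> sphere 0 1 - E" for \<zeta>
      unfolding has_nontangential_limit_def scaleR_fun_def real_scaleR_def
    proof (intro allI impI tendsto_mult_right_zero)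
      fix M :: real
      assume "M > 1"
      then show "(u \<longlongrightarrow> 0) (at \<zeta> within nontangential_region M \<zeta>)"
        using u(5) that unfolding has_nontangential_limit_def by blast
    qed
  qed (use u(3,4) in \<open>simp_all\<close>)
qed

subsection \<open>Poisson kernels\<close>

text \<open>For \<open>cmod a = 1\<close> and \<open>z\<close> in the disc this is
  \<open>(1 - (cmod z)^2) / (cmod (a - z))^2\<close>; as the real part of a holomorphic function it
  is visibly harmonic. The value 0 off the disc matches the chosen representation of functions on
  the disc.\<close>

definition disc_poisson_kernel :: "complex \<Rightarrow> complex \<Rightarrow> real"
  where "disc_poisson_kernel a z = (if z \<in> ball 0 1 then Re ((a + z) / (a - z)) else 0)"

text \<open>\<open>(a + z) * cnj (a - z)\<close> is \<open>(cmod a)^2 - (cmod z)^2\<close> plus the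
  purely imaginary \<open>z * cnj a - a * cnj z\<close>. At \<open>a = z\<close> the value comes
  from the convention \<open>x / 0 = 0\<close>.\<close>

lemma Re_add_divide_diff_sphere:
  assumes "cmod a = 1" "cmod z = 1"
  shows "Re ((a + z) / (a - z)) = 0"
proof -
  have "Re a ^ 2 + Im a ^ 2 = 1" "Re z ^ 2 + Im z ^ 2 = 1"
    using assms by (simp_all flip: cmod_power2)
  then have "Re ((a + z) * cnj (a - z)) = 0"
    by (simp add: algebra_simps power2_eq_square)
  then show ?thesis
    by (simp add: Re_divide algebra_simps)
qed

text \<open>The quotient is continuous away from its pole \<open>a\<close>, and its real part
  vanishes on the rest of the circle. Hence even the unrestricted limit from the disc is 0 at every
  boundary point other than \<open>a\<close>.\<close>

lemma disc_poisson_kernel_in_harmonic_null_functions: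
  assumes a: "a \<in> sphere 0 1"
  shows "disc_poisson_kernel a \<in> harmonic_null_functions"
  unfolding harmonic_null_functions_def
proof (intro CollectI conjI allI impI exI[of _ "{a}"] ballI)
  have "(\<lambda>z. (a + z) / (a - z)) holomorphic_on ball 0 1"
    using a by (intro holomorphic_intros) auto
  then show "harmonic_on (ball 0 1) (disc_poisson_kernel a)"
    by (rule harmonic_on_Re_holomorphic) (auto simp: disc_poisson_kernel_def)
next
  fix \<zeta> assume \<zeta>: "\<zeta> \<in> sphere 0 1 - {a}"
  show "has_nontangential_limit (disc_poisson_kernel a) 0 \<zeta>"
    unfolding has_nontangential_limit_def
  proof (intro allI impI)
    fix M :: real
    have "((\<lambda>z. Re ((a + z) / (a - z))) \<longlongrightarrow> Re ((a + \<zeta>) / (a - \<zeta>)))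
        (at \<zeta> within nontangential_region M \<zeta>)"
      using \<zeta> by (intro tendsto_intros) auto
    moreover have "Re ((a + \<zeta>) / (a - \<zeta>)) = 0"
      using a \<zeta> by (intro Re_add_divide_diff_sphere) auto
    \<comment> \<open>The region lies inside the disc, where the kernel is given by the
      quotient.\<close>
    moreover have "\<forall>\<^sub>F z in at \<zeta> within nontangential_region M \<zeta>.
        Re ((a + z) / (a - z)) = disc_poisson_kernel a z"
      unfolding eventually_at_filter
      by (rule always_eventually) (auto simp: nontangential_region_def disc_poisson_kernel_def)
    ultimately show "(disc_poisson_kernel a \<longlongrightarrow> 0) (at \<zeta> within nontangential_region M \<zeta>)"
      using tendsto_cong by fastforce
  qed
qed (use a in \<open>auto simp: disc_poisson_kernel_def\<close>)

text \<open>On the radius to \<open>a\<close> the kernel with pole \<open>a\<close> equals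
  \<open>(1 + r) / (1 - r)\<close>, and the weight \<open>1 - r\<close> cancels the blow-up. A
  kernel with another pole has a finite limit at \<open>a\<close>, so the weight sends the product
  to 0.\<close>

lemma disc_poisson_kernel_radial_limit:
  assumes "a \<in> sphere 0 1" "b \<in> sphere 0 1"
  shows "((\<lambda>r. (1 - r) * disc_poisson_kernel b (of_real r * a)) \<longlongrightarrow> (if b = a then 2 else 0))
    (at_left 1)"
proof -
  \<comment> \<open>In this range \<open>of_real r * a\<close> lies in the disc and
    \<open>1 - r\<close> is nonzero.\<close>
  have *: "\<forall>\<^sub>F r in at_left 1. r \<in> {0<..<1::real}"
    by (rule eventually_at_left_real) simp
  have ball: "of_real r * a \<in> ball 0 1" if "r \<in> {0<..<1::real}" for r
    using that assms by (simp add: norm_mult)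
  have a0: "a \<noteq> 0" using assms by auto
  show ?thesis
  proof (cases "b = a")
    case True
    have "((\<lambda>r. 1 + r) \<longlongrightarrow> 1 + 1) (at_left (1::real))"
      by (intro tendsto_intros)
    moreover have "\<forall>\<^sub>F r in at_left 1. 1 + r = (1 - r) * disc_poisson_kernel a (of_real r * a)"
      using *
    proof eventually_elim
      case (elim r)
      have "(a + of_real r * a) / (a - of_real r * a) = (a * of_real (1 + r)) / (a * of_real (1 - r))"
        by (simp add: algebra_simps)
      also have "\<dots> = of_real ((1 + r) / (1 - r))"
        using a0 by simp
      finally show ?case
        using elim ball[OF elim] by (simp add: disc_poisson_kernel_def)
    qed
    ultimately show ?thesis
      using True by (simp add: tendsto_cong)
  next
    case False
    have "((\<lambda>r. (1 - r) * Re ((b + of_real r * a) / (b - of_real r * a)))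
        \<longlongrightarrow> (1 - 1) * Re ((b + of_real 1 * a) / (b - of_real 1 * a))) (at_left 1)"
      using False by (intro tendsto_intros) auto
    moreover have "\<forall>\<^sub>F r in at_left 1. (1 - r) * Re ((b + of_real r * a) / (b - of_real r * a))
        = (1 - r) * disc_poisson_kernel b (of_real r * a)"
      using * by eventually_elim (use ball in \<open>auto simp: disc_poisson_kernel_def\<close>)
    ultimately show ?thesis
      using False by (simp add: tendsto_cong)
  qed
qed

text \<open>The weighted radial limits towards \<open>a\<close> tell the kernels apart. Injectivity
  allows sums over kernels to be indexed by boundary points and makes the family infinite.\<close>

lemma inj_on_disc_poisson_kernel: "inj_on disc_poisson_kernel (sphere 0 1)"
proof (rule inj_onI, rule ccontr)
  fix a b assume a: "a \<in> sphere 0 1" and b: "b \<in> sphere 0 1"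
    and eq: "disc_poisson_kernel a = disc_poisson_kernel b" and neq: "a \<noteq> b"
  have "((\<lambda>r. (1 - r) * disc_poisson_kernel b (of_real r * a)) \<longlongrightarrow> 2) (at_left 1)"
    using disc_poisson_kernel_radial_limit[OF a a] by (simp add: eq)
  moreover have "((\<lambda>r. (1 - r) * disc_poisson_kernel b (of_real r * a)) \<longlongrightarrow> 0) (at_left 1)"
    using disc_poisson_kernel_radial_limit[OF a b] neq by (simp split: if_splits)
  ultimately have "(2::real) = 0"
    by (rule tendsto_unique[OF trivial_limit_at_left_real])
  then show False
    by simp
qed

section \<open>Linear independence and infinite dimension\<close>

lemma independent_disc_poisson_kernel: "independent (disc_poisson_kernel ` sphere 0 1)"
  unfolding independent_explicit_finite_subsets
proof (intro allI impI ballI)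
  fix T :: "(complex \<Rightarrow> real) set" and c :: "(complex \<Rightarrow> real) \<Rightarrow> real" and v
  assume T: "T \<subseteq> disc_poisson_kernel ` sphere 0 1" "finite T" "(\<Sum>v\<in>T. c v *\<^sub>R v) = 0" and v: "v \<in> T"
  obtain A where A: "A \<subseteq> sphere 0 1" "T = disc_poisson_kernel ` A"
    using T(1) by (auto simp: subset_image_iff)
  have inj: "inj_on disc_poisson_kernel A"
    using inj_on_disc_poisson_kernel A(1) by (rule inj_on_subset)
  have fin: "finite A"
    using T(2) A inj finite_imageD by blast
  obtain a where a: "a \<in> A" "v = disc_poisson_kernel a"
    using v A by auto
  define k where "k b = c (disc_poisson_kernel b)" for b
  have sum_eq: "(\<Sum>b\<in>A. k b *\<^sub>R disc_poisson_kernel b) = 0"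
    using T(3) by (simp add: A(2) sum.reindex[OF inj] k_def)
  have apply_sum: "(\<Sum>b\<in>B. k b *\<^sub>R disc_poisson_kernel b) z
      = (\<Sum>b\<in>B. k b * disc_poisson_kernel b z)" if "finite B" for B z
    using that by induction auto
  \<comment> \<open>The relation is tested along the radius to the very point \<open>a\<close> whose
    coefficient must vanish; in the limit only the term \<open>b = a\<close> survives.\<close>
  have "((\<lambda>r. \<Sum>b\<in>A. k b * ((1 - r) * disc_poisson_kernel b (of_real r * a)))
      \<longlongrightarrow> (\<Sum>b\<in>A. k b * (if b = a then 2 else 0))) (at_left 1)"
    using A a by (intro tendsto_intros disc_poisson_kernel_radial_limit) auto
  \<comment> \<open>Each weighted sum is \<open>1 - r\<close> times the vanishing combination
    evaluated at \<open>of_real r * a\<close>, so the limit \<open>k a * 2\<close> must be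
    0.\<close>
  moreover have "(\<Sum>b\<in>A. k b * ((1 - r) * disc_poisson_kernel b (of_real r * a))) = 0" for r
  proof -
    have "(\<Sum>b\<in>A. k b * ((1 - r) * disc_poisson_kernel b (of_real r * a)))
        = (1 - r) * (\<Sum>b\<in>A. k b *\<^sub>R disc_poisson_kernel b) (of_real r * a)"
      by (simp add: apply_sum[OF fin] sum_distrib_left mult_ac)
    then show ?thesis
      by (simp add: sum_eq)
  qed
  moreover have "(\<Sum>b\<in>A. k b * (if b = a then 2 else 0)) = k a * 2"
    using fin a by (simp add: if_distrib[of "\<lambda>x. _ * x"] cong: if_cong)
  ultimately show "c v = 0"
    using a by (simp add: k_def tendsto_const_iff)
qed

theorem theorem1:
  shows "subspace harmonic_null_functions \<and> infinite_dimensional harmonic_null_functions"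
proof
  show "infinite_dimensional harmonic_null_functions"
    unfolding infinite_dimensional_def
  proof
    assume "\<exists>B :: (complex \<Rightarrow> real) set. finite B \<and> harmonic_null_functions \<subseteq> span B"
    then obtain B :: "(complex \<Rightarrow> real) set"
      where B: "finite B" "harmonic_null_functions \<subseteq> span B" by blast
    have "disc_poisson_kernel ` sphere 0 1 \<subseteq> span B"
      using disc_poisson_kernel_in_harmonic_null_functions B(2) by blast
    \<comment> \<open>Steinitz exchange: an independent set in the span of the finite set
      \<open>B\<close> has at most \<open>card B\<close> elements.\<close>
    then have "finite (disc_poisson_kernel ` sphere 0 1)"
      using independent_span_bound[OF B(1) independent_disc_poisson_kernel] by blast
    then have "finite (sphere (0::complex) 1)"
      using finite_imageD inj_on_disc_poisson_kernel by blast
    \<comment> \<open>A connected set with two distinct points is uncountable, so the circle cannot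
      be finite.\<close>
    moreover have "connected (sphere (0::complex) 1)"
      by (rule connected_sphere) simp
    moreover have "1 \<in> sphere (0::complex) 1" "-1 \<in> sphere (0::complex) 1" "(1::complex) \<noteq> -1"
      by simp_all
    ultimately show False
      using connected_uncountable countable_finite by blast
  qed
qed (rule subspace_harmonic_null_functions)

end
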